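(* Let $G=(V,E)$ be a directed graph on $p\ge 2$ nodes, $V=\{0,1,\dots,p-1\}$, that has a self-loop at every node, is otherwise acyclic (i.e. becomes a directed acyclic graph when all self-loops are deleted), and has no isolated nodes. Consider the corresponding fourth-order discrete Lyapunov model with edge weight matrix $A$, whose self-loop weights $a_{ii}$ are non-zero for all $i\in V$. If $G$ is known (i.e. the zero pattern of $A$ is known), then $A$, $\Omega^{(2)}$, $\Omega^{(3)}$ and $\Omega^{(4)}$ are generically identifiable from the second-, third- and fourth-order cumulants $(S,T,R)$.
   Context: A directed graph $G=(V,E)$ has $E\subseteq V\times V$ (self-loops allowed); a node is isolated if no edge connects it to a different node. $\mathbb{R}^E$ is the set of real $p\times p$ matrices $A=(a_{ji})$ with $a_{ji}=0$ whenever $i\to j\notin E$; $\mathbb{R}^E_{\mathrm{stab}}\subseteq\mathbb{R}^E$ is the subset of Schur stable matrices (all complex eigenvalues have absolute value $<1$). For a diagonal symmetric tensor $\Omega^{(m)}$ of order $m$ on $\mathbb{R}^p$ (represented by its diagonal entries $\omega^{(m)}_0,\dots,\omega^{(m)}_{p-1}$) and $A\in\mathbb{R}^E_{\mathrm{stab}}$, let $T_m$ be the unique solution of the $m$th-order discrete Lyapunov equation $T_m=T_m\times_1A\times_2\cdots\times_mA+\Omega^{(m)}$, where $(T\times_kA)_{i_1\cdots i_{k-1}\,j\,i_{k+1}\cdots i_m}=\sum_{i_k}T_{i_1\cdots i_m}A_{j i_k}$. Write $S=T_2$, $T=T_3$, $R=T_4$. Parameter space: $\Theta$ is the set of tuples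 $\theta=(A,\Omega^{(2)},\Omega^{(3)},\Omega^{(4)})\in\mathbb{R}^E_{\mathrm{stab}}\times\mathbb{R}_{+}^p\times(\mathbb{R}\setminus\{0\})^p\times\mathbb{R}_{+}^p$ with $a_{ii}\ne 0$ for all $i$, where $\mathbb{R}_+$ denotes the positive reals. Let $\varphi(\theta)=(S,T,R)$. "Generically identifiable" means: there is a proper algebraic subset $Z$ of $\Theta$ (the intersection of $\Theta$ with the zero set of polynomials in the free parameters, not all of $\Theta$) such that $\varphi^{-1}(\varphi(\theta))=\{\theta\}$ for all $\theta\in\Theta\setminus Z$. *)

theory Defs
  imports "HOL-Analysis.Analysis"
begin

text \<open>
  The node set is a finite type \<open>'n\<close>, with \<open>p = CARD('n)\<close>; a directed graph is its edge relation
  \<open>E\<close>, where \<open>(i, j) \<in> E\<close> means \<open>i \<rightarrow> j\<close>. Note the transposition between edges and matrix entries: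
  the weight \<open>a\<^sub>j\<^sub>i = A $ j $ i\<close> belongs to the edge \<open>i \<rightarrow> j\<close>.
\<close>

definition isolated_node :: "('n \<times> 'n) set \<Rightarrow> 'n \<Rightarrow> bool" where
  "isolated_node E i \<longleftrightarrow> (\<forall>j. j \<noteq> i \<longrightarrow> (i, j) \<notin> E \<and> (j, i) \<notin> E)"

definition edge_matrices :: "('n::finite \<times> 'n) set \<Rightarrow> (real^'n^'n) set" where
  "edge_matrices E = {A. \<forall>i j. (i, j) \<notin> E \<longrightarrow> A $ j $ i = 0}"

definition complex_eigenvalue :: "real^'n^'n \<Rightarrow> complex \<Rightarrow> bool" where
  "complex_eigenvalue A \<mu> \<longleftrightarrow>
     (\<exists>v::complex^'n. v \<noteq> 0 \<and> map_matrix complex_of_real A *v v = \<mu> *s v)"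

definition schur_stable :: "real^'n^'n \<Rightarrow> bool" where
  "schur_stable A \<longleftrightarrow> (\<forall>\<mu>. complex_eigenvalue A \<mu> \<longrightarrow> norm \<mu> < 1)"

definition stable_edge_matrices :: "('n::finite \<times> 'n) set \<Rightarrow> (real^'n^'n) set" where
  "stable_edge_matrices E = {A \<in> edge_matrices E. schur_stable A}"

text \<open>
  A tensor of order \<open>m\<close> on \<open>\<real>\<^sup>p\<close> is a function on multi-indices, given as lists of length \<open>m\<close>;
  it is fixed to be \<open>0\<close> on lists of any other length, so that equality of tensors is equality of
  functions. Modes are counted from \<open>0\<close>.
\<close>

type_synonym 'n tensor = "'n list \<Rightarrow> real"

definition tensors :: "nat \<Rightarrow> 'n tensor set" where
  "tensors m = {T. \<forall>is. length is \<noteq> m \<longrightarrow> T is = 0}"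

definition mode_product :: "nat \<Rightarrow> real^'n^'n \<Rightarrow> 'n tensor \<Rightarrow> 'n::finite tensor" where
  "mode_product k A T = (\<lambda>js. \<Sum>i\<in>UNIV. T (js[k := i]) * A $ (js ! k) $ i)"

text \<open>The product in all modes, \<open>(\<dots>(T \<times>\<^sub>1 A) \<times>\<^sub>2 \<dots>) \<times>\<^sub>m A\<close>:\<close>

definition multi_mode_product :: "nat \<Rightarrow> real^'n^'n \<Rightarrow> 'n tensor \<Rightarrow> 'n::finite tensor" where
  "multi_mode_product m A T = fold (\<lambda>k. mode_product k A) [0..<m] T"

text \<open>Only orders \<open>m \<ge> 1\<close> are meaningful here.\<close>

definition diag_tensor :: "nat \<Rightarrow> real^'n \<Rightarrow> 'n tensor" where
  "diag_tensor m \<omega> = (\<lambda>is. if is = replicate m (hd is) then \<omega> $ hd is else 0)"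

definition lyapunov_solution :: "nat \<Rightarrow> real^'n^'n \<Rightarrow> real^'n \<Rightarrow> 'n::finite tensor \<Rightarrow> bool" where
  "lyapunov_solution m A \<omega> T \<longleftrightarrow>
     T \<in> tensors m \<and> T = (\<lambda>is. multi_mode_product m A T is + diag_tensor m \<omega> is)"

text \<open>For Schur stable \<open>A\<close> the equation has exactly one solution.\<close>

definition lyapunov_cumulant :: "nat \<Rightarrow> real^'n^'n \<Rightarrow> real^'n \<Rightarrow> 'n::finite tensor" where
  "lyapunov_cumulant m A \<omega> = (THE T. lyapunov_solution m A \<omega> T)"

text \<open>Parameters \<open>(A, \<Omega>\<^sup>(\<^sup>2\<^sup>), \<Omega>\<^sup>(\<^sup>3\<^sup>), \<Omega>\<^sup>(\<^sup>4\<^sup>))\<close>, the diagonal tensors being given by their diagonals.\<close>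

type_synonym 'n param = "(real^'n^'n) \<times> (real^'n) \<times> (real^'n) \<times> (real^'n)"

definition param_space :: "('n::finite \<times> 'n) set \<Rightarrow> 'n param set" where
  "param_space E = {(A, \<omega>2, \<omega>3, \<omega>4).
     A \<in> stable_edge_matrices E \<and> (\<forall>i. A $ i $ i \<noteq> 0) \<and>
     (\<forall>i. \<omega>2 $ i > 0) \<and> (\<forall>i. \<omega>3 $ i \<noteq> 0) \<and> (\<forall>i. \<omega>4 $ i > 0)}"

definition cumulants :: "'n::finite param \<Rightarrow> 'n tensor \<times> 'n tensor \<times> 'n tensor" where
  "cumulants = (\<lambda>(A, \<omega>2, \<omega>3, \<omega>4).
     (lyapunov_cumulant 2 A \<omega>2, lyapunov_cumulant 3 A \<omega>3, lyapunov_cumulant 4 A \<omega>4))"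

text \<open>
  Polynomials are taken in all coordinates of the ambient space. On \<open>param_space E\<close> these restrict
  to exactly the polynomials in the free parameters, because the entries of \<open>A\<close> off \<open>E\<close> vanish.
\<close>

definition algebraic_subset :: "'a::euclidean_space set \<Rightarrow> 'a set \<Rightarrow> bool" where
  "algebraic_subset \<Theta> Z \<longleftrightarrow>
     (\<exists>F. (\<forall>f\<in>F. real_polynomial_function f) \<and> Z = {\<theta> \<in> \<Theta>. \<forall>f\<in>F. f \<theta> = 0})"

definition generically_identifiable :: "'a::euclidean_space set \<Rightarrow> ('a \<Rightarrow> 'b) \<Rightarrow> bool" where
  "generically_identifiable \<Theta> \<phi> \<longleftrightarrow>
     (\<exists>Z. algebraic_subset \<Theta> Z \<and> Z \<noteq> \<Theta> \<and> (\<forall>\<theta>\<in>\<Theta> - Z. {\<theta>' \<in> \<Theta>. \<phi> \<theta>' = \<phi> \<theta>} = {\<theta>}))"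

end

theory Submission
  imports Defs
begin

text \<open>
  Order the nodes so that every \<open>A\<close> is triangular. Then the diagonal of a stable \<open>A\<close> lies in
  \<open>(-1, 1)\<close> and the cumulants are rational in the parameters without poles on the parameter space.

  Let \<open>j\<close> be a source with loop weight \<open>a\<close>, \<open>e\<close> a first child of it, \<open>b = a\<^sub>e\<^sub>j\<close>, \<open>d = a\<^sub>e\<^sub>e\<close>, and
  let \<open>g\<^sub>n\<close> be the quotient of the cumulants of order \<open>n + 1\<close> at \<open>(j, \<dots>, j, e)\<close> and \<open>(j, \<dots>, j)\<close>.
  Then \<open>g\<^sub>n = a\<^sup>n (b + d g\<^sub>n)\<close>, i.e. \<open>1/a\<^sup>n = b/g\<^sub>n + d\<close>, for \<open>n = 1, 2, 3\<close>, and taking differences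
  eliminates \<open>b\<close> and \<open>d\<close>.

  For any other node \<open>j\<close>, let the rows of its set \<open>P\<close> of ancestors be known, and suppose that two rows
  \<open>j\<close> fit the cumulants. Their difference annihilates all second and third cumulants with \<open>X\<^sub>P\<close>. If it
  is nonzero at \<open>j\<close>, then \<open>X\<^sub>j\<close> behaves like some combination \<open>v \<bullet> X\<^sub>P\<close> in these cumulants, and the
  Lyapunov equations yield a vector \<open>y\<close> with \<open>A S y = \<omega>\<^sub>2 v\<close> and \<open>A (T y) A\<^sup>T = diag (\<omega>\<^sub>3 v)\<close> on \<open>P\<close>.
  Eliminating \<open>v\<close> leaves a square linear system for \<open>y\<close> which is diagonal and regular at \<open>A = I/2\<close>,
  hence generically regular; and \<open>y = 0\<close> forces the edges into \<open>j\<close> to have weight zero.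
\<close>

section \<open>The Lyapunov equation in coordinates\<close>

text \<open>Entry of a Kronecker power of \<open>A\<close> at two multi-indices; with it the
  Lyapunov equation becomes a linear system on lists of length \<open>m\<close>. Lists of different
  lengths get 0.\<close>

fun kron :: "real^'n^'n \<Rightarrow> 'n list \<Rightarrow> 'n list \<Rightarrow> real" where
  "kron A [] [] = 1"
| "kron A (j # js) (i # is) = A $ j $ i * kron A js is"
| "kron A _ _ = 0"

lemma finite_lists_length: "finite {is :: 'n::finite list. length is = m}"
  using finite_lists_length_eq[of "UNIV :: 'n set" m] by simp

lemma sum_lists_Suc:
  fixes g :: "'n::finite list \<Rightarrow> real"
  shows "(\<Sum>is | length is = Suc m. g is) = (\<Sum>i\<in>UNIV. \<Sum>is | length is = m. g (i # is))"
proof -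
  have "{is :: 'n list. length is = Suc m} = (\<lambda>(i, is). i # is) ` (UNIV \<times> {is. length is = m})"
    by (auto simp: length_Suc_conv image_iff)
  moreover have "inj_on (\<lambda>(i, is). i # is) (UNIV \<times> {is :: 'n list. length is = m})"
    by (auto simp: inj_on_def)
  ultimately have "(\<Sum>is | length is = Suc m. g is)
      = sum (g \<circ> (\<lambda>(i, is). i # is)) (UNIV \<times> {is. length is = m})"
    by (simp only: sum.reindex)
  also have "\<dots> = (\<Sum>i\<in>UNIV. \<Sum>is | length is = m. g (i # is))"
    by (simp add: sum.cartesian_product case_prod_unfold)
  finally show ?thesis .
qed

lemma mode_product_Suc_Cons:
  "mode_product (Suc k) A T (j # js) = mode_product k A (\<lambda>is. T (j # is)) js"
  by (simp add: mode_product_def)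

lemma fold_mode_product_Suc_Cons:
  "fold (\<lambda>k. mode_product (Suc k) A) ks T (j # js)
     = fold (\<lambda>k. mode_product k A) ks (\<lambda>is. T (j # is)) js"
proof (induction ks arbitrary: T)
  case (Cons k ks)
  show ?case by (simp add: Cons.IH mode_product_Suc_Cons[abs_def])
qed simp

lemma multi_mode_product_0: "multi_mode_product 0 A T js = T js"
  by (simp add: multi_mode_product_def)

text \<open>Mode 0 is applied first, and the later modes never touch the head of the list, so the
  modes can be peeled off one at a time.\<close>

lemma multi_mode_product_Suc_Cons:
  "multi_mode_product (Suc m) A T (j # js)
     = multi_mode_product m A (\<lambda>is. \<Sum>i\<in>UNIV. T (i # is) * A $ j $ i) js"
proof -
  have *: "[0..<Suc m] = 0 # map Suc [0..<m]"
    by (simp add: upt_conv_Cons map_Suc_upt del: upt_Suc)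
  have "multi_mode_product (Suc m) A T (j # js)
      = fold (\<lambda>k. mode_product (Suc k) A) [0..<m] (mode_product 0 A T) (j # js)"
    unfolding multi_mode_product_def * by (simp add: fold_map comp_def)
  also have "\<dots> = multi_mode_product m A (\<lambda>is. mode_product 0 A T (j # is)) js"
    unfolding multi_mode_product_def by (rule fold_mode_product_Suc_Cons)
  also have "(\<lambda>is. mode_product 0 A T (j # is)) = (\<lambda>is. \<Sum>i\<in>UNIV. T (i # is) * A $ j $ i)"
    by (simp add: mode_product_def)
  finally show ?thesis .
qed

lemma multi_mode_product_eq_sum:
  assumes "length js = m"
  shows "multi_mode_product m A T js = (\<Sum>is | length is = m. kron A js is * T is)"
  using assms
proof (induction m arbitrary: js T)
  case 0
  then show ?case by (simp add: multi_mode_product_0)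
next
  case (Suc m)
  then obtain j ks where js: "js = j # ks" and len: "length ks = m"
    by (auto simp: length_Suc_conv)
  show ?case
    unfolding js multi_mode_product_Suc_Cons Suc.IH[OF len] sum_lists_Suc
    by (subst sum.swap) (simp add: sum_distrib_left mult_ac)
qed

lemma multi_mode_product_eq_0:
  assumes "T \<in> tensors m" "length js \<noteq> m"
  shows "multi_mode_product m A T js = 0"
proof -
  have "fold (\<lambda>k. mode_product k A) ks T \<in> tensors m" if "T \<in> tensors m" for ks T
    using that by (induction ks arbitrary: T) (auto simp: tensors_def mode_product_def)
  then show ?thesis
    using assms by (auto simp: multi_mode_product_def tensors_def)
qed

lemma lyapunov_solution_iff:
  "lyapunov_solution m A \<omega> T \<longleftrightarrow> T \<in> tensors m \<and>
     (\<forall>js. length js = m \<longrightarrow>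
       T js = (\<Sum>is | length is = m. kron A js is * T is) + diag_tensor m \<omega> js)"
proof -
  have "T js = multi_mode_product m A T js + diag_tensor m \<omega> js"
    if "T \<in> tensors m" "length js \<noteq> m" for js
  proof -
    \<comment> \<open>\<open>hd js\<close> is unspecified for the empty list, but no list of the
      wrong length is a \<open>replicate m\<close>, so the noise term vanishes here.\<close>
    have "js \<noteq> replicate m (hd js)" using that(2) by (metis length_replicate)
    then show ?thesis
      using that by (simp add: multi_mode_product_eq_0 diag_tensor_def tensors_def)
  qed
  then show ?thesis
    unfolding lyapunov_solution_def fun_eq_iff using multi_mode_product_eq_sum by metis
qed

lemma lyapunov_solution_2:
  assumes "lyapunov_solution 2 A \<omega> T"
  shows "T [u, v] = (\<Sum>k\<in>UNIV. A $ u $ k * (\<Sum>l\<in>UNIV. A $ v $ l * T [k, l]))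
           + (if u = v then \<omega> $ u else 0)"
proof -
  have "T [u, v] = multi_mode_product 2 A T [u, v] + diag_tensor 2 \<omega> [u, v]"
    using assms unfolding lyapunov_solution_def by metis
  moreover have "multi_mode_product 2 A T [u, v]
      = (\<Sum>k\<in>UNIV. A $ u $ k * (\<Sum>l\<in>UNIV. A $ v $ l * T [k, l]))"
    by (subst multi_mode_product_eq_sum)
      (simp_all add: numeral_2_eq_2 sum_lists_Suc sum_distrib_left mult_ac)
  ultimately show ?thesis
    by (auto simp: numeral_2_eq_2 diag_tensor_def)
qed

lemma lyapunov_solution_3:
  assumes "lyapunov_solution 3 A \<omega> T"
  shows "T [u, v, w] = (\<Sum>k\<in>UNIV. A $ u $ k * (\<Sum>l\<in>UNIV. A $ v $ l *
           (\<Sum>m\<in>UNIV. A $ w $ m * T [k, l, m]))) + (if u = v \<and> v = w then \<omega> $ u else 0)"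
proof -
  have "T [u, v, w] = multi_mode_product 3 A T [u, v, w] + diag_tensor 3 \<omega> [u, v, w]"
    using assms unfolding lyapunov_solution_def by metis
  moreover have "multi_mode_product 3 A T [u, v, w] = (\<Sum>k\<in>UNIV. A $ u $ k * (\<Sum>l\<in>UNIV. A $ v $ l *
           (\<Sum>m\<in>UNIV. A $ w $ m * T [k, l, m])))"
    by (subst multi_mode_product_eq_sum)
      (simp_all add: numeral_3_eq_3 sum_lists_Suc sum_distrib_left mult_ac)
  ultimately show ?thesis
    by (auto simp: numeral_3_eq_3 diag_tensor_def)
qed

text \<open>Row \<open>j\<close> has at most its loop entry, so each of the \<open>n\<close> modes
  at index \<open>j\<close> only contributes a factor \<open>A $ j $ j\<close>.\<close>

lemma multi_mode_product_replicate_append: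
  assumes "\<And>i. i \<noteq> j \<Longrightarrow> A $ j $ i = 0"
  shows "multi_mode_product (Suc n) A T (replicate n j @ [k])
    = A $ j $ j ^ n * (\<Sum>l\<in>UNIV. A $ k $ l * T (replicate n j @ [l]))"
proof (induction n arbitrary: T)
  case 0
  show ?case by (simp add: multi_mode_product_Suc_Cons multi_mode_product_0 mult.commute)
next
  case (Suc n)
  have "(\<Sum>i\<in>UNIV. T (i # is) * A $ j $ i) = A $ j $ j * T (j # is)" for "is"
    using assms by (subst sum.remove[of _ j]) (auto intro!: sum.neutral)
  then show ?case
    by (simp add: multi_mode_product_Suc_Cons[of "Suc n"] Suc.IH sum_distrib_left mult_ac)
qed

lemma lyapunov_solution_source:
  assumes "lyapunov_solution (Suc n) A \<omega> T" "n \<ge> 1"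
    and "\<And>i. i \<noteq> j \<Longrightarrow> A $ j $ i = 0"
  shows "T (replicate n j @ [k]) = A $ j $ j ^ n * (\<Sum>l\<in>UNIV. A $ k $ l * T (replicate n j @ [l]))
           + (if k = j then \<omega> $ j else 0)"
proof -
  \<comment> \<open>This is where \<open>n \<ge> 1\<close> enters: for \<open>n = 0\<close> the head
    is \<open>k\<close>, and noise appears at every \<open>k\<close>.\<close>
  have hd: "hd (replicate n j @ [k]) = j"
    using assms(2) by (cases n) auto
  have "replicate n j @ [k] = replicate (Suc n) j \<longleftrightarrow> k = j"
    by (simp flip: replicate_append_same)
  then have "diag_tensor (Suc n) \<omega> (replicate n j @ [k]) = (if k = j then \<omega> $ j else 0)"
    unfolding diag_tensor_def hd by (simp only:)
  moreover have "T (replicate n j @ [k]) = multi_mode_product (Suc n) A T (replicate n j @ [k])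
      + diag_tensor (Suc n) \<omega> (replicate n j @ [k])"
    by (rule fun_cong[OF conjunct2[OF assms(1)[unfolded lyapunov_solution_def]]])
  ultimately show ?thesis
    using multi_mode_product_replicate_append[of j A n T k] assms(3) by simp
qed

text \<open>For fixed \<open>A\<close> and \<open>T\<close> the noise is the residual of the
  equation at constant multi-indices.\<close>

lemma lyapunov_solution_unique_diag:
  assumes "lyapunov_solution (Suc n) A \<omega> T" "lyapunov_solution (Suc n) A \<omega>' T"
  shows "\<omega> = \<omega>'"
proof -
  have "\<omega> $ i = \<omega>' $ i" for i
  proof -
    have "diag_tensor (Suc n) \<omega> (replicate (Suc n) i) = diag_tensor (Suc n) \<omega>' (replicate (Suc n) i)"
      using assms unfolding lyapunov_solution_def fun_eq_iff by (metis add_left_cancel)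
    then show ?thesis by (simp add: diag_tensor_def)
  qed
  then show ?thesis by (simp add: vec_eq_iff)
qed

section \<open>Matrices supported on a directed acyclic graph with loops\<close>

definition ancestors :: "('n \<times> 'n) set \<Rightarrow> 'n \<Rightarrow> 'n set" where
  "ancestors E j = {i. (i, j) \<in> (E - Id)\<^sup>+}"

text \<open>Replaces a topological order: the number of proper ancestors grows strictly along every
  non-loop edge.\<close>

definition depth :: "('n::finite \<times> 'n) set \<Rightarrow> 'n \<Rightarrow> nat" where
  "depth E j = card (ancestors E j)"

lemma parent_ancestor: "(i, j) \<in> E \<Longrightarrow> i \<noteq> j \<Longrightarrow> i \<in> ancestors E j"
  by (auto simp: ancestors_def)

lemma ancestors_trans: "i \<in> ancestors E k \<Longrightarrow> k \<in> ancestors E j \<Longrightarrow> i \<in> ancestors E j"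
  by (auto simp: ancestors_def)

locale loop_dag =
  fixes E :: "('n::finite \<times> 'n) set"
  assumes acyclic: "acyclic (E - Id)"
begin

lemma not_ancestor_self: "j \<notin> ancestors E j"
  using acyclic by (auto simp: ancestors_def acyclic_def)

lemma depth_less: "i \<in> ancestors E j \<Longrightarrow> depth E i < depth E j"
  using ancestors_trans[of _ E i j] not_ancestor_self[of i]
  unfolding depth_def by (intro psubset_card_mono) auto

lemma edge_matrix_nonzeroD:
  "A \<in> edge_matrices E \<Longrightarrow> A $ j $ i \<noteq> 0 \<Longrightarrow> i = j \<or> i \<in> ancestors E j"
  unfolding edge_matrices_def by (auto intro: parent_ancestor)

lemma row_sum_eq_diag:
  assumes "A \<in> edge_matrices E" "\<And>k. k \<in> ancestors E j \<Longrightarrow> g k = 0"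
  shows "(\<Sum>k\<in>UNIV. A $ j $ k * g k) = A $ j $ j * g j"
proof -
  have "A $ j $ k * g k = 0" if "k \<noteq> j" for k
    using edge_matrix_nonzeroD[OF assms(1), of j k] assms(2)[of k] that by auto
  then have "(\<Sum>k\<in>UNIV - {j}. A $ j $ k * g k) = 0"
    by (intro sum.neutral) auto
  then show ?thesis by (subst sum.remove[of _ j]) auto
qed

text \<open>The ancestors of \<open>j\<close> are closed under taking ancestors, so the
  corresponding block of \<open>A\<close> is triangular with nonzero diagonal; this is forward
  substitution along \<open>depth\<close>.\<close>

lemma row_sums_zero_imp_zero:
  assumes "A \<in> edge_matrices E" "\<And>i. A $ i $ i \<noteq> 0"
    and "\<And>u. u \<in> ancestors E j \<Longrightarrow> (\<Sum>k\<in>UNIV. A $ u $ k * g k) = 0"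
  shows "u \<in> ancestors E j \<Longrightarrow> g u = 0"
proof (induction "depth E u" arbitrary: u rule: less_induct)
  case less
  have "A $ u $ u * g u = 0"
    using row_sum_eq_diag[OF assms(1), of u g] less assms(3)[of u] ancestors_trans depth_less
    by metis
  then show ?case using assms(2) by simp
qed

text \<open>Vectors supported on the descendants of \<open>i\<close> (including \<open>i\<close>) are mapped by \<open>A - a\<^sub>i\<^sub>i I\<close> to
  vectors supported on the proper descendants, so the kernel is nontrivial.\<close>

lemma stable_diag_less_1:
  assumes "A \<in> stable_edge_matrices E"
  shows "\<bar>A $ i $ i\<bar> < 1"
proof -
  define B where "B = A - mat (A $ i $ i)"
  define D where "D = {k. k = i \<or> i \<in> ancestors E k}"
  define V where "V = (\<lambda>D. {v::real^'n. \<forall>k. k \<notin> D \<longrightarrow> v $ k = 0})"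
  have A: "A \<in> edge_matrices E" "schur_stable A"
    using assms by (auto simp: stable_edge_matrices_def)
  have B_apply: "(B *v v) $ k = (\<Sum>l\<in>UNIV. A $ k $ l * v $ l) - A $ i $ i * v $ k" for v k
    unfolding B_def matrix_vector_mult_diff_rdistrib
    by (simp add: matrix_vector_mult_def mat_def if_distrib if_distribR cong: if_cong)
  have "(B *v v) \<in> V (D - {i})" if v: "v \<in> V D" for v
    unfolding V_def
  proof (clarify)
    fix k assume "k \<notin> D - {i}"
    then consider "k = i" | "k \<notin> D" by blast
    then show "(B *v v) $ k = 0"
    proof cases
      case 1
      have "v $ l = 0" if "l \<in> ancestors E i" for l
      proof -
        have "l \<notin> D"
          using that ancestors_trans[of i E l i] not_ancestor_self[of i] by (auto simp: D_def)
        then show ?thesis using v by (simp add: V_def)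
      qed
      then show ?thesis
        using row_sum_eq_diag[OF A(1), of i "\<lambda>l. v $ l"] 1 by (simp add: B_apply)
    next
      case 2
      have "v $ l = 0" if "l \<in> ancestors E k" for l
      proof -
        have "l \<notin> D" using that 2 ancestors_trans[of i E l k] by (auto simp: D_def)
        then show ?thesis using v by (simp add: V_def)
      qed
      moreover have "v $ k = 0" using v 2 by (auto simp: V_def)
      ultimately show ?thesis
        using row_sum_eq_diag[OF A(1), of k "\<lambda>l. v $ l"] by (simp add: B_apply)
    qed
  qed
  then have sub: "(*v) B ` V D \<subseteq> V (D - {i})" by blast
  have dim: "dim (V D) = card D" for D
    unfolding V_def using dim_substandard_cart[where 'a=real and d=D] by (simp add: dim_vec_eq)
  \<comment> \<open>Otherwise \<open>B\<close> would embed \<open>V D\<close>, of dimension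
    \<open>card D\<close>, into \<open>V (D - {i})\<close>, whose dimension is one less.\<close>
  have "\<exists>v\<in>V D. v \<noteq> 0 \<and> B *v v = 0"
  proof (rule ccontr)
    assume contr: "\<not> ?thesis"
    have subsp: "subspace (V D)" by (auto simp: V_def subspace_def)
    have "inj_on ((*v) B) (V D)"
    proof (rule inj_onI)
      fix x y assume "x \<in> V D" "y \<in> V D" "B *v x = B *v y"
      then have "x - y \<in> V D" "B *v (x - y) = 0"
        by (auto simp: V_def matrix_vector_mult_diff_distrib)
      then show "x = y" using contr by auto
    qed
    then have "dim ((*v) B ` V D) = dim (V D)"
      using subsp by (intro dim_image_eq) (simp_all add: span_eq_iff[THEN iffD2])
    then have "card D \<le> card (D - {i})"
      using dim_subset[OF sub] by (simp add: dim)
    moreover have "card (D - {i}) < card D"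
      by (rule card_Diff1_less) (auto simp: D_def)
    ultimately show False by simp
  qed
  then obtain v where v: "v \<noteq> 0" "B *v v = 0" by blast
  define w :: "complex^'n" where "w = (\<chi> k. complex_of_real (v $ k))"
  have "w \<noteq> 0" using v(1) by (auto simp: w_def vec_eq_iff)
  moreover have "map_matrix complex_of_real A *v w = complex_of_real (A $ i $ i) *s w"
  proof -
    have "(\<Sum>l\<in>UNIV. A $ k $ l * v $ l) = A $ i $ i * v $ k" for k
      using arg_cong[OF v(2), of "\<lambda>x. x $ k"] by (simp add: B_apply)
    then have "(\<Sum>l\<in>UNIV. complex_of_real (A $ k $ l) * complex_of_real (v $ l))
        = complex_of_real (A $ i $ i) * complex_of_real (v $ k)" for k
      by (metis (no_types, lifting) of_real_mult of_real_sum sum.cong)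
    then show ?thesis
      by (simp add: vec_eq_iff matrix_vector_mult_def w_def map_matrix_def)
  qed
  ultimately have "complex_eigenvalue A (complex_of_real (A $ i $ i))"
    unfolding complex_eigenvalue_def by blast
  then show ?thesis using A(2) by (auto simp: schur_stable_def)
qed

text \<open>At a node of minimal depth in the support of an eigenvector, the eigenvalue equation
  involves only the diagonal entry, so every eigenvalue is a diagonal entry.\<close>

lemma schur_stableI:
  assumes "A \<in> edge_matrices E" "\<And>i. \<bar>A $ i $ i\<bar> < 1"
  shows "schur_stable A"
  unfolding schur_stable_def complex_eigenvalue_def
proof (clarify)
  fix \<mu> and v :: "complex^'n"
  assume v: "v \<noteq> 0" "map_matrix complex_of_real A *v v = \<mu> *s v"
  define I where "I = {i. v $ i \<noteq> 0}"
  have "I \<noteq> {}" using v(1) by (auto simp: I_def vec_eq_iff)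
  then obtain i where i: "i \<in> I" "\<And>k. k \<in> I \<Longrightarrow> depth E i \<le> depth E k"
    using ex_min_if_finite[of "depth E ` I"] by (auto simp: not_less)
  have "complex_of_real (A $ i $ k) * v $ k = 0" if "k \<noteq> i" for k
    using edge_matrix_nonzeroD[OF assms(1), of i k] that depth_less[of k i] i(2)[of k]
    by (force simp: I_def)
  then have "(\<Sum>k\<in>UNIV - {i}. complex_of_real (A $ i $ k) * v $ k) = 0"
    by (intro sum.neutral) auto
  then have "(\<Sum>k\<in>UNIV. complex_of_real (A $ i $ k) * v $ k) = complex_of_real (A $ i $ i) * v $ i"
    by (subst sum.remove[of _ i]) auto
  then have "complex_of_real (A $ i $ i) * v $ i = \<mu> * v $ i"
    using arg_cong[OF v(2), of "\<lambda>x. x $ i"] by (simp add: matrix_vector_mult_def map_matrix_def)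
  then have "\<mu> = complex_of_real (A $ i $ i)" using i(1) by (auto simp: I_def)
  then show "norm \<mu> < 1" using assms(2)[of i] by simp
qed

section \<open>Existence and uniqueness of the cumulant tensors\<close>

text \<open>The grading of multi-indices in which the Kronecker powers of \<open>A\<close> are
  triangular.\<close>

definition total_depth :: "'n list \<Rightarrow> nat" where
  "total_depth js = sum_list (map (depth E) js)"

lemma kron_nonzeroD:
  assumes "A \<in> edge_matrices E" "kron A js is \<noteq> 0"
  shows "is = js \<or> total_depth is < total_depth js"
  using assms
proof (induction A js "is" rule: kron.induct)
  case (2 A j js i "is")
  then show ?case
    using edge_matrix_nonzeroD[of A j i] depth_less[of i j] by (auto simp: total_depth_def)
qed auto

lemma abs_kron_diag_less_1:
  assumes "A \<in> stable_edge_matrices E" "js \<noteq> []"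
  shows "\<bar>kron A js js\<bar> < 1"
  using assms(2)
proof (induction js)
  case (Cons j js)
  then have "\<bar>kron A js js\<bar> \<le> 1" by (cases "js = []") auto
  then have "\<bar>A $ j $ j\<bar> * \<bar>kron A js js\<bar> \<le> \<bar>A $ j $ j\<bar>"
    by (simp add: mult_left_le)
  then show ?case
    using stable_diag_less_1[OF assms(1), of j] by (simp add: abs_mult)
qed simp

text \<open>The Lyapunov equation at \<open>js\<close> solved for \<open>T js\<close>: the diagonal
  coefficient is moved to the left, and by triangularity the rest needs \<open>T\<close> only at
  smaller total depth.\<close>

definition lyapunov_step :: "nat \<Rightarrow> real^'n^'n \<Rightarrow> real^'n \<Rightarrow> 'n tensor \<Rightarrow> 'n tensor" where
  "lyapunov_step m A \<omega> T js =
     (if length js = m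
      then ((\<Sum>is | length is = m \<and> total_depth is < total_depth js. kron A js is * T is)
            + diag_tensor m \<omega> js) / (1 - kron A js js)
      else 0)"

lemma lyapunov_solution_iff_step:
  assumes "A \<in> stable_edge_matrices E" "m \<ge> 1"
  shows "lyapunov_solution m A \<omega> T \<longleftrightarrow> (\<forall>js. T js = lyapunov_step m A \<omega> T js)"
proof -
  have A: "A \<in> edge_matrices E" using assms by (auto simp: stable_edge_matrices_def)
  have "T js = (\<Sum>is | length is = m. kron A js is * T is) + diag_tensor m \<omega> js \<longleftrightarrow>
      T js = lyapunov_step m A \<omega> T js" if len: "length js = m" for js
  proof -
    let ?L = "{is. length is = m \<and> total_depth is < total_depth js}"
    have fin: "finite ?L" by (rule finite_subset[OF _ finite_lists_length[of m]]) auto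
    have "kron A js is * T is = 0" if "is \<notin> insert js ?L" "length is = m" for "is"
      using kron_nonzeroD[OF A, of js "is"] that by auto
    then have "(\<Sum>is | length is = m. kron A js is * T is)
        = (\<Sum>is\<in>insert js ?L. kron A js is * T is)"
      using len by (intro sum.mono_neutral_right finite_lists_length) auto
    also have "\<dots> = kron A js js * T js + (\<Sum>is\<in>?L. kron A js is * T is)"
      using fin by simp
    finally have "(\<Sum>is | length is = m. kron A js is * T is) = \<dots>" .
    \<comment> \<open>For the empty list \<open>kron\<close> is 1 and the denominator would vanish;
      \<open>m \<ge> 1\<close> excludes it.\<close>
    moreover have "js \<noteq> []" using len assms(2) by auto
    ultimately show ?thesis
      using len abs_kron_diag_less_1[OF assms(1), of js]
      by (auto simp: lyapunov_step_def field_simps)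
  qed
  moreover have "T js = 0 \<longleftrightarrow> T js = lyapunov_step m A \<omega> T js" if "length js \<noteq> m" for js
    using that by (simp add: lyapunov_step_def)
  ultimately show ?thesis
    unfolding lyapunov_solution_iff tensors_def mem_Collect_eq by blast
qed

lemma lyapunov_solution_ex1:
  assumes "A \<in> stable_edge_matrices E" "m \<ge> 1"
  shows "\<exists>!T. lyapunov_solution m A \<omega> T"
proof -
  have step_cong: "lyapunov_step m A \<omega> T js = lyapunov_step m A \<omega> T' js"
    if "\<And>is. total_depth is < total_depth js \<Longrightarrow> T is = T' is" for T T' js
    using that by (auto simp: lyapunov_step_def intro!: sum.cong arg_cong2[where f="(/)"])
  \<comment> \<open>Existence by well-founded recursion; \<open>step_cong\<close> shows that the
    values cut off by \<open>wfrec\<close> do not matter. Uniqueness is the matching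
    induction.\<close>
  define T where "T = wfrec (Wellfounded.measure total_depth) (lyapunov_step m A \<omega>)"
  have "T js = lyapunov_step m A \<omega> T js" for js
    unfolding T_def
    by (subst wfrec[OF wf_measure]) (rule step_cong, simp add: cut_apply)
  moreover have "T1 = T2"
    if "\<And>js. T1 js = lyapunov_step m A \<omega> T1 js" "\<And>js. T2 js = lyapunov_step m A \<omega> T2 js" for T1 T2
  proof
    show "T1 js = T2 js" for js
    proof (induction js rule: measure_induct_rule[where f=total_depth])
      case (less js)
      have "lyapunov_step m A \<omega> T1 js = lyapunov_step m A \<omega> T2 js"
        by (rule step_cong) (rule less)
      from trans[OF that(1) trans[OF this that(2)[symmetric]]] show ?case .
    qed
  qed
  ultimately show ?thesis
    unfolding lyapunov_solution_iff_step[OF assms] by (intro ex1I[of _ T]) blast+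
qed

lemma lyapunov_cumulant_solution:
  assumes "A \<in> stable_edge_matrices E" "m \<ge> 1"
  shows "lyapunov_solution m A \<omega> (lyapunov_cumulant m A \<omega>)"
  unfolding lyapunov_cumulant_def by (rule theI'[OF lyapunov_solution_ex1[OF assms]])

end

section \<open>Identification of the self-loop weight of a source\<close>

text \<open>In \<open>(1 / a) ^ n = b / g n + d\<close> the difference of consecutive equations
  removes \<open>d\<close>, and the quotient of two differences removes \<open>b\<close>. What
  remains expresses \<open>1 / a\<close> through \<open>g\<close> alone.\<close>

lemma power_ratio_cancel:
  fixes a a' :: real
  assumes "a \<noteq> 0" "a' \<noteq> 0" "\<bar>a\<bar> < 1" "\<bar>a'\<bar> < 1"
    and "\<And>n. n \<in> {1, 2, 3} \<Longrightarrow> g n \<noteq> 0"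
    and g: "\<And>n. n \<in> {1, 2, 3} \<Longrightarrow> g n = a ^ n * (b + d * g n)"
    and g': "\<And>n. n \<in> {1, 2, 3} \<Longrightarrow> g n = a' ^ n * (b' + d' * g n)"
  shows "a = a'"
proof -
  have inv: "(1 / x) ^ n = y * (1 / g n) + z"
    if "n \<in> {1, 2, 3}" "x \<noteq> 0" "g n = x ^ n * (y + z * g n)" for n x y z
    using that assms(5)[OF that(1)] by (simp add: field_simps)
  have key: "1 / g 3 - 1 / g 2 = 1 / x * (1 / g 2 - 1 / g 1)"
    if x: "x \<noteq> 0" and eq: "\<And>n. n \<in> {1, 2, 3} \<Longrightarrow> g n = x ^ n * (y + z * g n)" and "x \<noteq> 1" for x y z
  proof -
    define \<alpha> where "\<alpha> = 1 / x"
    have \<alpha>: "\<alpha> \<noteq> 0" "\<alpha> \<noteq> 1" using x \<open>x \<noteq> 1\<close> by (auto simp: \<alpha>_def)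
    have i: "\<alpha> = y * (1 / g 1) + z" "\<alpha>\<^sup>2 = y * (1 / g 2) + z" "\<alpha> ^ 3 = y * (1 / g 3) + z"
      using inv[of 1 x y z] inv[of 2 x y z] inv[of 3 x y z] x eq[of 1] eq[of 2] eq[of 3]
      by (simp_all add: \<alpha>_def del: One_nat_def)
    have "y * (1 / g 2 - 1 / g 1) = \<alpha>\<^sup>2 - \<alpha>" "y * (1 / g 3 - 1 / g 2) = \<alpha> ^ 3 - \<alpha>\<^sup>2"
      using i by (simp_all add: algebra_simps)
    moreover have "\<alpha> ^ 3 - \<alpha>\<^sup>2 = \<alpha> * (\<alpha>\<^sup>2 - \<alpha>)" by (simp add: power2_eq_square power3_eq_cube algebra_simps)
    ultimately have "y * (1 / g 3 - 1 / g 2) = y * (\<alpha> * (1 / g 2 - 1 / g 1))"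
      by (metis mult.left_commute)
    \<comment> \<open>If \<open>y = 0\<close>, then \<alpha> equals its own square and is 0 or
      1.\<close>
    moreover have "y \<noteq> 0"
      using i(1,2) \<alpha> by (auto simp: power2_eq_square)
    ultimately show ?thesis by (metis \<alpha>_def mult_left_cancel)
  qed
  \<comment> \<open>This difference is the common factor to be cancelled between the two instances
    of \<open>key\<close>.\<close>
  have "1 / g 2 \<noteq> 1 / g 1"
  proof
    assume "1 / g 2 = 1 / g 1"
    then have "(1 / a)\<^sup>2 = 1 / a"
      using inv[of 1 a b d] inv[of 2 a b d] g[of 1] g[of 2] assms(1) by (simp del: One_nat_def)
    then show False using assms(1,3) by (auto simp: power2_eq_square)
  qed
  then show ?thesis
    using key[of a b d] key[of a' b' d'] g g' assms(1-4) by auto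
qed

context loop_dag
begin

lemma source_row:
  assumes "A \<in> edge_matrices E" "ancestors E j = {}" "i \<noteq> j"
  shows "A $ j $ i = 0"
  using edge_matrix_nonzeroD[OF assms(1), of j i] assms(2,3) by auto

text \<open>The ancestors of a node that does not descend from \<open>j\<close> are of the same
  kind, so by induction the equation shrinks to \<open>T = c * T\<close> with
  \<open>\<bar>c\<bar> < 1\<close>.\<close>

lemma source_cumulant_nondescendant:
  assumes A: "A \<in> stable_edge_matrices E" and T: "lyapunov_solution (Suc n) A \<omega> T" "n \<ge> 1"
    and j: "ancestors E j = {}"
  shows "k \<noteq> j \<Longrightarrow> j \<notin> ancestors E k \<Longrightarrow> T (replicate n j @ [k]) = 0"
proof (induction "depth E k" arbitrary: k rule: less_induct)
  case less
  have edge: "A \<in> edge_matrices E" using A by (auto simp: stable_edge_matrices_def)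
  have "T (replicate n j @ [l]) = 0" if "l \<in> ancestors E k" for l
    using less that depth_less[OF that] ancestors_trans[of j E l k] by blast
  then have "T (replicate n j @ [k]) = A $ j $ j ^ n * (A $ k $ k * T (replicate n j @ [k]))"
    using lyapunov_solution_source[OF T source_row[OF edge j], where k=k] less(2)
      row_sum_eq_diag[OF edge, of k "\<lambda>l. T (replicate n j @ [l])"] by simp
  moreover have "\<bar>A $ j $ j ^ n * A $ k $ k\<bar> < 1"
  proof -
    have "\<bar>A $ j $ j\<bar> ^ n \<le> 1"
      using stable_diag_less_1[OF A, of j] by (intro power_le_one) auto
    then have "\<bar>A $ j $ j\<bar> ^ n * \<bar>A $ k $ k\<bar> \<le> \<bar>A $ k $ k\<bar>"
      by (simp add: mult_left_le_one_le)
    then show ?thesis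
      using stable_diag_less_1[OF A, of k] by (simp add: abs_mult power_abs)
  qed
  ultimately show ?case by (smt (verit) mult.assoc mult_cancel_right1)
qed

lemma source_cumulant_self:
  assumes A: "A \<in> stable_edge_matrices E" and T: "lyapunov_solution (Suc n) A \<omega> T" "n \<ge> 1"
    and j: "ancestors E j = {}" and "\<omega> $ j \<noteq> 0"
  shows "T (replicate n j @ [j]) \<noteq> 0"
proof -
  have edge: "A \<in> edge_matrices E" using A by (auto simp: stable_edge_matrices_def)
  have "T (replicate n j @ [j]) = A $ j $ j ^ n * (A $ j $ j * T (replicate n j @ [j])) + \<omega> $ j"
    using lyapunov_solution_source[OF T source_row[OF edge j], where k=j]
      row_sum_eq_diag[OF edge, of j "\<lambda>l. T (replicate n j @ [l])"] j by simp
  then show ?thesis using assms(5) by auto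
qed

text \<open>By \<open>first\<close>, the only nodes with a nonzero cumulant in row \<open>e\<close>
  are \<open>j\<close> and \<open>e\<close>; every other parent of \<open>e\<close> is neither
  \<open>j\<close> nor a descendant of \<open>j\<close>.\<close>

lemma source_cumulant_child:
  assumes A: "A \<in> stable_edge_matrices E" and T: "lyapunov_solution (Suc n) A \<omega> T" "n \<ge> 1"
    and j: "ancestors E j = {}" and e: "e \<noteq> j"
    and first: "\<And>k. (k, e) \<in> E \<Longrightarrow> k \<noteq> e \<Longrightarrow> j \<notin> ancestors E k"
  shows "T (replicate n j @ [e]) = A $ j $ j ^ n *
    (A $ e $ j * T (replicate n j @ [j]) + A $ e $ e * T (replicate n j @ [e]))"
proof -
  have edge: "A \<in> edge_matrices E" using A by (auto simp: stable_edge_matrices_def)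
  have "A $ e $ k * T (replicate n j @ [k]) = 0" if "k \<noteq> e" "k \<noteq> j" for k
    using source_cumulant_nondescendant[OF A T j, of k] first[of k] that edge
    by (cases "(k, e) \<in> E") (auto simp: edge_matrices_def)
  then have "(\<Sum>k\<in>UNIV. A $ e $ k * T (replicate n j @ [k]))
      = (\<Sum>k\<in>{j, e}. A $ e $ k * T (replicate n j @ [k]))"
    by (intro sum.mono_neutral_right) auto
  then show ?thesis
    using lyapunov_solution_source[OF T source_row[OF edge j], where k=e] e by simp
qed

text \<open>Choose a child \<open>e\<close> of minimal depth. A path from \<open>j\<close> to
  another parent of \<open>e\<close> would start with a child of \<open>j\<close> that is an
  ancestor of \<open>e\<close>, hence of smaller depth.\<close>

lemma source_first_child:
  assumes "ancestors E j = {}" "\<not> isolated_node E j"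
  obtains e where "e \<noteq> j" "(j, e) \<in> E" "\<And>k. (k, e) \<in> E \<Longrightarrow> k \<noteq> e \<Longrightarrow> j \<notin> ancestors E k"
proof -
  let ?C = "{e. e \<noteq> j \<and> (j, e) \<in> E}"
  have "?C \<noteq> {}"
    using assms parent_ancestor[of _ j E] by (auto simp: isolated_node_def)
  then obtain e where e: "e \<in> ?C" "\<And>k. k \<in> ?C \<Longrightarrow> depth E e \<le> depth E k"
    using ex_min_if_finite[of "depth E ` ?C"] by (auto simp: not_less)
  have "j \<notin> ancestors E k" if k: "(k, e) \<in> E" "k \<noteq> e" for k
  proof
    assume "j \<in> ancestors E k"
    then obtain e' where e': "(j, e') \<in> E - Id" "(e', k) \<in> (E - Id)\<^sup>*"
      unfolding ancestors_def by (auto dest: tranclD)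
    have "e' \<in> ancestors E e"
      using e'(2) k by (auto simp: ancestors_def intro: rtrancl_into_trancl1)
    then show False using e(2)[of e'] e'(1) depth_less[of e' e] by auto
  qed
  then show ?thesis using that e(1) by blast
qed

lemma source_loop_weight_unique:
  assumes A: "A \<in> stable_edge_matrices E" "A' \<in> stable_edge_matrices E"
    and T: "\<And>m. m \<in> {2, 3, 4} \<Longrightarrow> lyapunov_solution m A (\<omega> m) (T m)"
    and T': "\<And>m. m \<in> {2, 3, 4} \<Longrightarrow> lyapunov_solution m A' (\<omega>' m) (T m)"
    and \<omega>: "\<And>m. m \<in> {2, 3, 4} \<Longrightarrow> \<omega> m $ j \<noteq> 0"
    and nz: "A $ j $ j \<noteq> 0" "A' $ j $ j \<noteq> 0" "\<And>e. (j, e) \<in> E \<Longrightarrow> A $ e $ j \<noteq> 0"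
    and j: "ancestors E j = {}" "\<not> isolated_node E j"
  shows "A $ j $ j = A' $ j $ j"
proof -
  obtain e where e: "e \<noteq> j" "(j, e) \<in> E"
    and first: "\<And>k. (k, e) \<in> E \<Longrightarrow> k \<noteq> e \<Longrightarrow> j \<notin> ancestors E k"
    using source_first_child[OF j] by metis
  \<comment> \<open>Order \<open>n + 1\<close> leaves \<open>n\<close> copies of \<open>j\<close>,
    hence the power \<open>n\<close> of the loop weight: orders 2, 3, 4 give the exponents 1, 2,
    3.\<close>
  define f where "f n k = T (Suc n) (replicate n j @ [k])" for n k
  define g where "g n = f n e / f n j" for n
  have m: "Suc n \<in> {2, 3, 4}" "n \<ge> 1" if "n \<in> {1, 2, 3}" for n :: nat using that by auto
  have fj: "f n j \<noteq> 0" if "n \<in> {1, 2, 3}" for n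
    unfolding f_def
    using source_cumulant_self[OF A(1) T[OF m(1)] m(2) j(1) \<omega>[OF m(1)]] that by blast
  have g: "g n = A $ j $ j ^ n * (A $ e $ j + A $ e $ e * g n)" if n: "n \<in> {1, 2, 3}" for n
    using source_cumulant_child[OF A(1) T[OF m(1)[OF n]] m(2)[OF n] j(1) e(1) first] fj[OF n]
    by (simp add: g_def f_def divide_simps)
  have g': "g n = A' $ j $ j ^ n * (A' $ e $ j + A' $ e $ e * g n)" if n: "n \<in> {1, 2, 3}" for n
    using source_cumulant_child[OF A(2) T'[OF m(1)[OF n]] m(2)[OF n] j(1) e(1) first] fj[OF n]
    by (simp add: g_def f_def divide_simps)
  have "g n \<noteq> 0" if n: "n \<in> {1, 2, 3}" for n
    using g[OF n] nz(1) nz(3)[OF e(2)] by auto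
  then show ?thesis
    using power_ratio_cancel[of _ _ g, OF nz(1,2) stable_diag_less_1[OF A(1)] stable_diag_less_1[OF A(2)]]
      g g' by blast
qed

section \<open>Identification of the row of a node with known ancestors\<close>

text \<open>The matrix of the linear system for \<open>y\<close>, from \<open>\<omega>\<^sub>3 A S y = \<omega>\<^sub>2 diag (A (T y) A\<^sup>T)\<close>.\<close>

definition obstruction ::
  "real^'n^'n \<Rightarrow> real^'n \<Rightarrow> real^'n \<Rightarrow> 'n tensor \<Rightarrow> 'n tensor \<Rightarrow> 'n \<Rightarrow> 'n \<Rightarrow> real" where
  "obstruction A \<omega>2 \<omega>3 S T u l =
     \<omega>3 $ u * (\<Sum>k\<in>UNIV. A $ u $ k * S [k, l])
     - \<omega>2 $ u * (\<Sum>k\<in>UNIV. A $ u $ k * (\<Sum>k'\<in>UNIV. A $ u $ k' * T [k, k', l]))"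

text \<open>Padded with the identity outside the ancestors, so that a determinant over the whole
  node type measures the ancestor block.\<close>

definition ancestor_matrix ::
  "real^'n^'n \<Rightarrow> real^'n \<Rightarrow> real^'n \<Rightarrow> 'n tensor \<Rightarrow> 'n tensor \<Rightarrow> 'n \<Rightarrow> real^'n^'n" where
  "ancestor_matrix A \<omega>2 \<omega>3 S T j = (\<chi> u l.
     if u \<in> ancestors E j \<and> l \<in> ancestors E j then obstruction A \<omega>2 \<omega>3 S T u l
     else if u = l then 1 else 0)"

text \<open>\<omega>3 times the second-order equation minus \<omega>2 times the third-order one
  cancels \<open>v\<close>, so \<open>y\<close> lies in the kernel of the ancestor matrix.\<close>

lemma ancestor_matrix_kernel:
  assumes det: "det (ancestor_matrix A \<omega>2 \<omega>3 S T j) \<noteq> 0"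
    and y: "\<And>l. l \<notin> ancestors E j \<Longrightarrow> y l = 0"
    and S: "\<And>u. u \<in> ancestors E j \<Longrightarrow>
      (\<Sum>k\<in>UNIV. A $ u $ k * (\<Sum>l\<in>UNIV. S [k, l] * y l)) = \<omega>2 $ u * v u"
    and T: "\<And>u. u \<in> ancestors E j \<Longrightarrow>
      (\<Sum>k\<in>UNIV. A $ u $ k * (\<Sum>k'\<in>UNIV. A $ u $ k' * (\<Sum>l\<in>UNIV. T [k, k', l] * y l)))
        = \<omega>3 $ u * v u"
  shows "y l = 0"
proof -
  let ?M = "ancestor_matrix A \<omega>2 \<omega>3 S T j"
  have sums: "(\<Sum>l\<in>UNIV. obstruction A \<omega>2 \<omega>3 S T u l * y l) =
      \<omega>3 $ u * (\<Sum>k\<in>UNIV. A $ u $ k * (\<Sum>l\<in>UNIV. S [k, l] * y l))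
      - \<omega>2 $ u * (\<Sum>k\<in>UNIV. A $ u $ k * (\<Sum>k'\<in>UNIV. A $ u $ k' * (\<Sum>l\<in>UNIV. T [k, k', l] * y l)))"
    for u
  proof -
    have "(\<Sum>l\<in>UNIV. (\<Sum>k\<in>UNIV. A $ u $ k * S [k, l]) * y l)
        = (\<Sum>k\<in>UNIV. A $ u $ k * (\<Sum>l\<in>UNIV. S [k, l] * y l))"
      by (simp add: sum_distrib_left sum_distrib_right mult.assoc) (rule sum.swap)
    moreover have "(\<Sum>l\<in>UNIV. (\<Sum>k\<in>UNIV. A $ u $ k * (\<Sum>k'\<in>UNIV. A $ u $ k' * T [k, k', l])) * y l)
        = (\<Sum>k\<in>UNIV. A $ u $ k * (\<Sum>k'\<in>UNIV. A $ u $ k' * (\<Sum>l\<in>UNIV. T [k, k', l] * y l)))"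
      unfolding sum_distrib_left sum_distrib_right mult.assoc
      by (subst sum.swap) (rule sum.cong[OF refl], rule sum.swap)
    ultimately show ?thesis
      by (simp add: obstruction_def left_diff_distrib sum_subtractf mult.assoc
          flip: sum_distrib_left)
  qed
  have "(\<Sum>l\<in>UNIV. ?M $ u $ l * y l) = 0" for u
  proof (cases "u \<in> ancestors E j")
    case True
    have "?M $ u $ l * y l = obstruction A \<omega>2 \<omega>3 S T u l * y l" for l
      using True y[of l] by (simp add: ancestor_matrix_def)
    then have "(\<Sum>l\<in>UNIV. ?M $ u $ l * y l) = (\<Sum>l\<in>UNIV. obstruction A \<omega>2 \<omega>3 S T u l * y l)"
      by (rule sum.cong[OF refl])
    then show ?thesis using sums[of u] S[OF True] T[OF True] by simp
  next
    case False
    have "?M $ u $ l * y l = 0" for l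
      using False y[of l] by (auto simp: ancestor_matrix_def)
    then show ?thesis by (intro sum.neutral ballI)
  qed
  then have "?M *v (\<chi> l. y l) = 0"
    by (simp add: vec_eq_iff matrix_vector_mult_def)
  then have "(\<chi> l. y l) = 0"
    using det by (metis invertible_det_nz matrix_left_invertible_ker invertible_left_inverse)
  then show ?thesis by (simp add: vec_eq_iff)
qed

text \<open>The kernel lemma is used twice: on \<open>y\<close>, to show that the two loop weights
  of \<open>j\<close> agree, and then on the difference \<open>c\<close> of the rows, which by then
  is supported on the ancestors.\<close>

lemma row_unique:
  assumes A: "A \<in> edge_matrices E" "A' \<in> edge_matrices E" "\<And>i. A $ i $ i \<noteq> 0"
    and S: "lyapunov_solution 2 A \<omega>2 S" "lyapunov_solution 2 A' \<omega>2' S"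
    and T: "lyapunov_solution 3 A \<omega>3 T" "lyapunov_solution 3 A' \<omega>3' T"
    and \<omega>2: "\<And>i. \<omega>2 $ i \<noteq> 0"
    and det: "det (ancestor_matrix A \<omega>2 \<omega>3 S T j) \<noteq> 0"
    and parent: "p \<in> ancestors E j" "A $ j $ p \<noteq> 0"
    and rows: "\<And>u. u \<in> ancestors E j \<Longrightarrow> A' $ u = A $ u"
  shows "A' $ j = A $ j"
proof -
  let ?P = "ancestors E j"
  define c where "c l = A $ j $ l - A' $ j $ l" for l
  have j: "j \<notin> ?P" by (rule not_ancestor_self)
  have c0: "c l = 0" if "l \<notin> ?P" "l \<noteq> j" for l
    using edge_matrix_nonzeroD[OF A(1), of j l] edge_matrix_nonzeroD[OF A(2), of j l] that
    unfolding c_def by (metis diff_self)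
  \<comment> \<open>Subtract the two equations at \<open>(u, j)\<close>: there is no noise because
    \<open>u \<noteq> j\<close>, and row \<open>u\<close> is common. The triangular ancestor block
    of \<open>A\<close> is then stripped off; for \<open>Tc\<close> this happens in two
    modes.\<close>
  have Sc: "(\<Sum>l\<in>UNIV. c l * S [u, l]) = 0" if "u \<in> ?P" for u
  proof (rule row_sums_zero_imp_zero[OF A(1,3) _ that])
    fix u assume u: "u \<in> ?P"
    then have "u \<noteq> j" using j by auto
    then have "(\<Sum>k\<in>UNIV. A $ u $ k * (\<Sum>l\<in>UNIV. A $ j $ l * S [k, l]))
        = (\<Sum>k\<in>UNIV. A $ u $ k * (\<Sum>l\<in>UNIV. A' $ j $ l * S [k, l]))"
      using lyapunov_solution_2[OF S(1), of u j] lyapunov_solution_2[OF S(2), of u j] rows[OF u]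
      by simp
    then show "(\<Sum>k\<in>UNIV. A $ u $ k * (\<Sum>l\<in>UNIV. c l * S [k, l])) = 0"
      by (simp add: c_def left_diff_distrib right_diff_distrib sum_subtractf)
  qed
  have Tc: "(\<Sum>m\<in>UNIV. c m * T [u, v, m]) = 0" if u: "u \<in> ?P" and v: "v \<in> ?P" for u v
  proof (rule row_sums_zero_imp_zero[OF A(1,3) _ v])
    fix v assume v: "v \<in> ?P"
    show "(\<Sum>l\<in>UNIV. A $ v $ l * (\<Sum>m\<in>UNIV. c m * T [u, l, m])) = 0"
    proof (rule row_sums_zero_imp_zero[OF A(1,3) _ u])
      fix u assume u: "u \<in> ?P"
      have "v \<noteq> j" using v j by auto
      then have "(\<Sum>k\<in>UNIV. A $ u $ k * (\<Sum>l\<in>UNIV. A $ v $ l * (\<Sum>m\<in>UNIV. A $ j $ m * T [k, l, m])))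
          = (\<Sum>k\<in>UNIV. A $ u $ k * (\<Sum>l\<in>UNIV. A $ v $ l * (\<Sum>m\<in>UNIV. A' $ j $ m * T [k, l, m])))"
        using lyapunov_solution_3[OF T(1), of u v j] lyapunov_solution_3[OF T(2), of u v j]
          rows[OF u] rows[OF v] by simp
      then show "(\<Sum>k\<in>UNIV. A $ u $ k * (\<Sum>l\<in>UNIV. A $ v $ l * (\<Sum>m\<in>UNIV. c m * T [k, l, m]))) = 0"
        by (simp add: c_def left_diff_distrib right_diff_distrib sum_subtractf)
    qed
  qed
  have row_sum_cong: "(\<Sum>k\<in>UNIV. A $ u $ k * g k) = (\<Sum>k\<in>UNIV. A $ u $ k * h k)"
    if u: "u \<in> ?P" and eq: "\<And>k. k \<in> ?P \<Longrightarrow> g k = h k" for u and g h :: "'n \<Rightarrow> real"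
  proof (rule sum.cong[OF refl])
    show "A $ u $ k * g k = A $ u $ k * h k" for k
      using edge_matrix_nonzeroD[OF A(1), of u k] eq[of k] u ancestors_trans[of k E u j] by auto
  qed
  have "c j = 0"
  proof (rule ccontr)
    assume cj: "c j \<noteq> 0"
    \<comment> \<open>Solves \<open>c \<bullet> s = 0\<close> for \<open>s j\<close>, which makes
      coordinate \<open>j\<close> a combination of the ancestor coordinates.\<close>
    define v where "v l = (if l \<in> ?P then - c l / c j else 0)" for l
    have elim: "s j = (\<Sum>l\<in>UNIV. v l * s l)" if "(\<Sum>l\<in>UNIV. c l * s l) = 0" for s
    proof -
      have "(\<Sum>l\<in>UNIV - {j}. c l * s l) = (\<Sum>l\<in>UNIV - {j}. - c j * (v l * s l))"
        by (rule sum.cong) (use cj c0 in \<open>auto simp: v_def\<close>)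
      moreover have "(\<Sum>l\<in>UNIV. v l * s l) = (\<Sum>l\<in>UNIV - {j}. v l * s l)"
        using j by (subst sum.remove[of _ j]) (auto simp: v_def)
      ultimately have "c j * s j = c j * (\<Sum>l\<in>UNIV. v l * s l)"
        using that by (subst (asm) sum.remove[of _ j]) (auto simp: sum_negf simp flip: sum_distrib_left)
      then show ?thesis using cj by simp
    qed
    \<comment> \<open>\<open>y\<close> compares the equation of \<open>X\<^sub>j\<close> with the one that \<open>v \<bullet> X\<close> would satisfy without noise.\<close>
    define y where "y l = (if l = j then 0 else A $ j $ l) + A $ j $ j * v l - (\<Sum>r\<in>UNIV. v r * A $ r $ l)"
      for l
    have y0: "y l = 0" if "l \<notin> ?P" for l
    proof -
      have v0: "v r * A $ r $ l = 0" for r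
        using edge_matrix_nonzeroD[OF A(1), of r l] that ancestors_trans[of l E r j]
        by (auto simp: v_def)
      have "(\<Sum>r\<in>UNIV. v r * A $ r $ l) = 0" using v0 by (intro sum.neutral ballI)
      moreover have "v l = 0" using that by (simp add: v_def)
      moreover have "l \<noteq> j \<Longrightarrow> A $ j $ l = 0"
        using edge_matrix_nonzeroD[OF A(1), of j l] that by auto
      ultimately show ?thesis by (simp add: y_def)
    qed
    \<comment> \<open>The loop term of row \<open>j\<close> is absent from the first summand of
      \<open>y\<close>; substituting \<open>v\<close> for coordinate \<open>j\<close> turns it into
      \<open>A $ j $ j * v l\<close>, which keeps \<open>y\<close> supported on the
      ancestors.\<close>
    have sum_y: "(\<Sum>l\<in>UNIV. s l * y l)
        = (\<Sum>l\<in>UNIV. A $ j $ l * s l) - (\<Sum>r\<in>UNIV. v r * (\<Sum>l\<in>UNIV. A $ r $ l * s l))"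
      if "s j = (\<Sum>l\<in>UNIV. v l * s l)" for s
    proof -
      have "(\<Sum>l\<in>UNIV. A $ j $ l * s l) = A $ j $ j * s j + (\<Sum>l\<in>UNIV - {j}. A $ j $ l * s l)"
        by (subst sum.remove[of _ j]) auto
      also have "(\<Sum>l\<in>UNIV - {j}. A $ j $ l * s l) = (\<Sum>l\<in>UNIV. (if l = j then 0 else A $ j $ l) * s l)"
        by (rule sum.mono_neutral_cong_left) auto
      finally have "(\<Sum>l\<in>UNIV. A $ j $ l * s l)
          = A $ j $ j * (\<Sum>l\<in>UNIV. v l * s l) + (\<Sum>l\<in>UNIV. (if l = j then 0 else A $ j $ l) * s l)"
        using that by simp
      moreover have "(\<Sum>r\<in>UNIV. v r * (\<Sum>l\<in>UNIV. A $ r $ l * s l))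
          = (\<Sum>l\<in>UNIV. (\<Sum>r\<in>UNIV. v r * A $ r $ l) * s l)"
        unfolding sum_distrib_left sum_distrib_right mult.assoc by (rule sum.swap)
      moreover have "(\<Sum>l\<in>UNIV. s l * y l) = (\<Sum>l\<in>UNIV. (if l = j then 0 else A $ j $ l) * s l)
          + A $ j $ j * (\<Sum>l\<in>UNIV. v l * s l) - (\<Sum>l\<in>UNIV. (\<Sum>r\<in>UNIV. v r * A $ r $ l) * s l)"
        by (simp add: y_def algebra_simps sum.distrib sum_subtractf sum_distrib_left)
      ultimately show ?thesis by simp
    qed
    have noise: "(\<Sum>r\<in>UNIV. v r * (if u = r then w else 0)) = v u * w" for u and w :: real
      by (simp add: if_distrib cong: if_cong)
    have Sy: "(\<Sum>k\<in>UNIV. A $ u $ k * (\<Sum>l\<in>UNIV. S [k, l] * y l)) = \<omega>2 $ u * v u"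
      if u: "u \<in> ?P" for u
    proof -
      have uj: "u \<noteq> j" using u j by auto
      have "(\<Sum>k\<in>UNIV. A $ u $ k * (\<Sum>l\<in>UNIV. S [k, l] * y l))
          = (\<Sum>k\<in>UNIV. A $ u $ k * ((\<Sum>l\<in>UNIV. A $ j $ l * S [k, l])
              - (\<Sum>r\<in>UNIV. v r * (\<Sum>l\<in>UNIV. A $ r $ l * S [k, l]))))"
        using elim[OF Sc] by (intro row_sum_cong[OF u] sum_y)
      also have "\<dots> = (\<Sum>k\<in>UNIV. A $ u $ k * (\<Sum>l\<in>UNIV. A $ j $ l * S [k, l]))
          - (\<Sum>r\<in>UNIV. v r * (\<Sum>k\<in>UNIV. A $ u $ k * (\<Sum>l\<in>UNIV. A $ r $ l * S [k, l])))"
        unfolding right_diff_distrib sum_subtractf sum_distrib_left[of "v _"]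
          sum_distrib_left[of _ "\<lambda>r. v r * _ r"]
        by (subst sum.swap) (simp add: sum_distrib_left mult_ac)
      also have "(\<Sum>k\<in>UNIV. A $ u $ k * (\<Sum>l\<in>UNIV. A $ j $ l * S [k, l])) = S [u, j]"
        using lyapunov_solution_2[OF S(1), of u j] uj by simp
      also have "(\<Sum>r\<in>UNIV. v r * (\<Sum>k\<in>UNIV. A $ u $ k * (\<Sum>l\<in>UNIV. A $ r $ l * S [k, l])))
          = (\<Sum>r\<in>UNIV. v r * (S [u, r] - (if u = r then \<omega>2 $ u else 0)))"
        by (subst lyapunov_solution_2[OF S(1)]) simp
      also have "\<dots> = S [u, j] - \<omega>2 $ u * v u"
        using elim[OF Sc[OF u]] by (simp add: right_diff_distrib sum_subtractf noise)
      finally show ?thesis by simp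
    qed
    have Ty: "(\<Sum>k\<in>UNIV. A $ u $ k * (\<Sum>k'\<in>UNIV. A $ u $ k' * (\<Sum>l\<in>UNIV. T [k, k', l] * y l)))
        = \<omega>3 $ u * v u" if u: "u \<in> ?P" for u
    proof -
      have uj: "u \<noteq> j" using u j by auto
      have "(\<Sum>k\<in>UNIV. A $ u $ k * (\<Sum>k'\<in>UNIV. A $ u $ k' * (\<Sum>l\<in>UNIV. T [k, k', l] * y l)))
          = (\<Sum>k\<in>UNIV. A $ u $ k * (\<Sum>k'\<in>UNIV. A $ u $ k' * ((\<Sum>l\<in>UNIV. A $ j $ l * T [k, k', l])
              - (\<Sum>r\<in>UNIV. v r * (\<Sum>l\<in>UNIV. A $ r $ l * T [k, k', l])))))"
        using elim[OF Tc] by (intro row_sum_cong[OF u] sum_y)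
      also have "\<dots> = (\<Sum>k\<in>UNIV. A $ u $ k * (\<Sum>k'\<in>UNIV. A $ u $ k' * (\<Sum>l\<in>UNIV. A $ j $ l * T [k, k', l])))
          - (\<Sum>k\<in>UNIV. \<Sum>k'\<in>UNIV. \<Sum>r\<in>UNIV. A $ u $ k * (A $ u $ k' * (v r * (\<Sum>l\<in>UNIV. A $ r $ l * T [k, k', l]))))"
        by (simp only: right_diff_distrib sum_subtractf sum_distrib_left)
      also have "(\<Sum>k\<in>UNIV. \<Sum>k'\<in>UNIV. \<Sum>r\<in>UNIV. A $ u $ k * (A $ u $ k' * (v r * (\<Sum>l\<in>UNIV. A $ r $ l * T [k, k', l]))))
          = (\<Sum>r\<in>UNIV. \<Sum>k\<in>UNIV. \<Sum>k'\<in>UNIV. A $ u $ k * (A $ u $ k' * (v r * (\<Sum>l\<in>UNIV. A $ r $ l * T [k, k', l]))))"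
        by (rule trans[OF sum.cong[OF refl sum.swap] sum.swap])
      also have "\<dots> = (\<Sum>r\<in>UNIV. v r * (\<Sum>k\<in>UNIV. A $ u $ k * (\<Sum>k'\<in>UNIV. A $ u $ k' * (\<Sum>l\<in>UNIV. A $ r $ l * T [k, k', l]))))"
        by (simp only: sum_distrib_left mult_ac)
      also have "(\<Sum>k\<in>UNIV. A $ u $ k * (\<Sum>k'\<in>UNIV. A $ u $ k' * (\<Sum>l\<in>UNIV. A $ j $ l * T [k, k', l]))) = T [u, u, j]"
        using lyapunov_solution_3[OF T(1), of u u j] uj by simp
      also have "(\<Sum>r\<in>UNIV. v r * (\<Sum>k\<in>UNIV. A $ u $ k * (\<Sum>k'\<in>UNIV. A $ u $ k' * (\<Sum>l\<in>UNIV. A $ r $ l * T [k, k', l]))))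
          = (\<Sum>r\<in>UNIV. v r * (T [u, u, r] - (if u = r then \<omega>3 $ u else 0)))"
        by (subst lyapunov_solution_3[OF T(1)]) simp
      also have "\<dots> = T [u, u, j] - \<omega>3 $ u * v u"
        using elim[OF Tc[OF u u]] by (simp add: right_diff_distrib sum_subtractf noise)
      finally show ?thesis by simp
    qed
    have y: "y l = 0" for l
      by (rule ancestor_matrix_kernel[OF det y0 Sy Ty])
    have v: "v u = 0" for u
      using Sy[of u] \<omega>2[of u] by (cases "u \<in> ?P") (auto simp: y v_def[of u])
    \<comment> \<open>With \<open>y\<close> and \<open>v\<close> zero, the definition of
      \<open>y\<close> at the parent \<open>p\<close> reduces to the edge weight
      \<open>A $ j $ p\<close>.\<close>
    show False
      using y[of p] parent j by (auto simp: y_def v split: if_splits)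
  qed
  then have c_supp: "c l = 0" if "l \<notin> ?P" for l using c0[of l] that by (cases "l = j") auto
  have "c l = 0" for l
  proof (rule ancestor_matrix_kernel[OF det c_supp, where v = "\<lambda>_. 0"])
    fix u assume u: "u \<in> ?P"
    have "(\<Sum>k\<in>UNIV. A $ u $ k * (\<Sum>l\<in>UNIV. S [k, l] * c l)) = (\<Sum>k\<in>UNIV. A $ u $ k * 0)"
      using Sc by (intro row_sum_cong[OF u]) (simp add: mult.commute)
    then show "(\<Sum>k\<in>UNIV. A $ u $ k * (\<Sum>l\<in>UNIV. S [k, l] * c l)) = \<omega>2 $ u * 0" by simp
    have "(\<Sum>k\<in>UNIV. A $ u $ k * (\<Sum>k'\<in>UNIV. A $ u $ k' * (\<Sum>l\<in>UNIV. T [k, k', l] * c l)))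
        = (\<Sum>k\<in>UNIV. A $ u $ k * (\<Sum>k'\<in>UNIV. A $ u $ k' * 0))"
      using Tc by (intro row_sum_cong[OF u]) (simp add: mult.commute)
    then show "(\<Sum>k\<in>UNIV. A $ u $ k * (\<Sum>k'\<in>UNIV. A $ u $ k' * (\<Sum>l\<in>UNIV. T [k, k', l] * c l)))
        = \<omega>3 $ u * 0" by simp
  qed
  then show ?thesis by (simp add: vec_eq_iff c_def)
qed

end

section \<open>Regular functions of the parameters\<close>

text \<open>One global quotient whose denominator has no zero on \<Theta>, so that nonvanishing of
  \<open>f\<close> becomes nonvanishing of the single polynomial \<open>p\<close>.\<close>

definition regular_on :: "'a::euclidean_space set \<Rightarrow> ('a \<Rightarrow> real) \<Rightarrow> bool" where
  "regular_on \<Theta> f \<longleftrightarrow> (\<exists>p q. real_polynomial_function p \<and> real_polynomial_function q \<and>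
     (\<forall>\<theta>\<in>\<Theta>. q \<theta> \<noteq> 0 \<and> f \<theta> = p \<theta> / q \<theta>))"

lemma regular_onI:
  "real_polynomial_function p \<Longrightarrow> real_polynomial_function q \<Longrightarrow>
     (\<And>\<theta>. \<theta> \<in> \<Theta> \<Longrightarrow> q \<theta> \<noteq> 0 \<and> f \<theta> = p \<theta> / q \<theta>) \<Longrightarrow> regular_on \<Theta> f"
  unfolding regular_on_def by blast

lemma regular_on_cong:
  "regular_on \<Theta> f \<Longrightarrow> (\<And>\<theta>. \<theta> \<in> \<Theta> \<Longrightarrow> f \<theta> = g \<theta>) \<Longrightarrow> regular_on \<Theta> g"
  unfolding regular_on_def by metis

lemma regular_on_polynomial: "real_polynomial_function p \<Longrightarrow> regular_on \<Theta> p"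
  by (rule regular_onI[of p "\<lambda>_. 1"]) (auto intro: real_polynomial_function.intros(2))

lemma regular_on_const: "regular_on \<Theta> (\<lambda>_. c)"
  by (intro regular_on_polynomial real_polynomial_function.intros(2))

lemma regular_on_add:
  assumes "regular_on \<Theta> f" "regular_on \<Theta> g"
  shows "regular_on \<Theta> (\<lambda>\<theta>. f \<theta> + g \<theta>)"
proof -
  obtain p q p' q' where "real_polynomial_function p" "real_polynomial_function q"
    "real_polynomial_function p'" "real_polynomial_function q'"
    and "\<forall>\<theta>\<in>\<Theta>. q \<theta> \<noteq> 0 \<and> f \<theta> = p \<theta> / q \<theta>" "\<forall>\<theta>\<in>\<Theta>. q' \<theta> \<noteq> 0 \<and> g \<theta> = p' \<theta> / q' \<theta>"
    using assms unfolding regular_on_def by blast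
  then show ?thesis
    by (intro regular_onI[of "\<lambda>\<theta>. p \<theta> * q' \<theta> + p' \<theta> * q \<theta>" "\<lambda>\<theta>. q \<theta> * q' \<theta>"])
      (auto intro: real_polynomial_function.intros simp: field_simps)
qed

lemma regular_on_mult:
  assumes "regular_on \<Theta> f" "regular_on \<Theta> g"
  shows "regular_on \<Theta> (\<lambda>\<theta>. f \<theta> * g \<theta>)"
proof -
  obtain p q p' q' where "real_polynomial_function p" "real_polynomial_function q"
    "real_polynomial_function p'" "real_polynomial_function q'"
    and "\<forall>\<theta>\<in>\<Theta>. q \<theta> \<noteq> 0 \<and> f \<theta> = p \<theta> / q \<theta>" "\<forall>\<theta>\<in>\<Theta>. q' \<theta> \<noteq> 0 \<and> g \<theta> = p' \<theta> / q' \<theta>"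
    using assms unfolding regular_on_def by blast
  then show ?thesis
    by (intro regular_onI[of "\<lambda>\<theta>. p \<theta> * p' \<theta>" "\<lambda>\<theta>. q \<theta> * q' \<theta>"])
      (auto intro: real_polynomial_function.intros)
qed

lemma regular_on_inverse:
  assumes "regular_on \<Theta> f" "\<And>\<theta>. \<theta> \<in> \<Theta> \<Longrightarrow> f \<theta> \<noteq> 0"
  shows "regular_on \<Theta> (\<lambda>\<theta>. inverse (f \<theta>))"
proof -
  obtain p q where "real_polynomial_function p" "real_polynomial_function q"
    "\<forall>\<theta>\<in>\<Theta>. q \<theta> \<noteq> 0 \<and> f \<theta> = p \<theta> / q \<theta>"
    using assms unfolding regular_on_def by blast
  then show ?thesis
    using assms(2) by (intro regular_onI[of q p]) force+
qed

lemma regular_on_diff: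
  assumes "regular_on \<Theta> f" "regular_on \<Theta> g"
  shows "regular_on \<Theta> (\<lambda>\<theta>. f \<theta> - g \<theta>)"
  using regular_on_add[OF assms(1) regular_on_mult[OF regular_on_const[of _ "-1"] assms(2)]] by simp

lemma regular_on_sum: "(\<And>i. i \<in> I \<Longrightarrow> regular_on \<Theta> (f i)) \<Longrightarrow> regular_on \<Theta> (\<lambda>\<theta>. \<Sum>i\<in>I. f i \<theta>)"
  by (induction I rule: infinite_finite_induct) (auto intro: regular_on_const regular_on_add)

lemma regular_on_prod: "(\<And>i. i \<in> I \<Longrightarrow> regular_on \<Theta> (f i)) \<Longrightarrow> regular_on \<Theta> (\<lambda>\<theta>. \<Prod>i\<in>I. f i \<theta>)"
  by (induction I rule: infinite_finite_induct) (auto intro: regular_on_const regular_on_mult)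

lemmas regular_on_intros =
  regular_on_const regular_on_add regular_on_mult regular_on_diff regular_on_sum regular_on_prod

lemma regular_on_det:
  fixes M :: "'a::euclidean_space \<Rightarrow> real^'n^'n"
  shows "(\<And>i j. regular_on \<Theta> (\<lambda>\<theta>. M \<theta> $ i $ j)) \<Longrightarrow> regular_on \<Theta> (\<lambda>\<theta>. det (M \<theta>))"
  unfolding det_def by (intro regular_on_intros)

lemma real_polynomial_function_coordinates:
  "real_polynomial_function (\<lambda>\<theta>::'n::finite param. fst \<theta> $ i $ j)"
  "real_polynomial_function (\<lambda>\<theta>::'n::finite param. fst (snd \<theta>) $ i)"
  "real_polynomial_function (\<lambda>\<theta>::'n::finite param. fst (snd (snd \<theta>)) $ i)"
  by (intro real_polynomial_function.intros(1)
      bounded_linear_compose[OF bounded_linear_vec_nth]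
      bounded_linear_compose[OF bounded_linear_fst]
      bounded_linear_compose[OF bounded_linear_snd]
      bounded_linear_fst bounded_linear_snd bounded_linear_ident)+

lemmas regular_on_coordinates = real_polynomial_function_coordinates[THEN regular_on_polynomial]

section \<open>Rationality of the cumulants and of the determinants\<close>

context loop_dag
begin

lemma regular_on_kron: "regular_on \<Theta> (\<lambda>\<theta>::'n param. kron (fst \<theta>) js is)"
proof (induction js arbitrary: "is")
  case Nil
  show ?case by (cases "is") (auto intro: regular_on_const)
next
  case (Cons j js)
  then show ?case
    by (cases "is") (auto intro: regular_on_const regular_on_mult regular_on_coordinates)
qed

text \<open>The recursion \<open>lyapunov_step\<close> uses only sums, products and division by
  \<open>1 - kron\<close>, which is nonzero for stable \<open>A\<close>; the induction follows total
  depth.\<close>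

lemma regular_on_lyapunov_cumulant:
  fixes w :: "'n param \<Rightarrow> real^'n"
  assumes w: "\<And>i. regular_on (param_space E) (\<lambda>\<theta>. w \<theta> $ i)" and m: "m \<ge> 1"
  shows "regular_on (param_space E) (\<lambda>\<theta>. lyapunov_cumulant m (fst \<theta>) (w \<theta>) js)"
proof (induction js rule: measure_induct_rule[where f=total_depth])
  case (less js)
  have stable: "fst \<theta> \<in> stable_edge_matrices E" if "\<theta> \<in> param_space E" for \<theta>
    using that by (auto simp: param_space_def)
  have diag: "regular_on (param_space E) (\<lambda>\<theta>. diag_tensor m (w \<theta>) js)"
    by (cases "js = replicate m (hd js)") (auto simp: diag_tensor_def intro: w regular_on_const)
  have nz: "1 - kron (fst \<theta>) js js \<noteq> 0" if "\<theta> \<in> param_space E" "length js = m" for \<theta>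
    using abs_kron_diag_less_1[OF stable[OF that(1)], of js] m that(2) by (cases "js = []") auto
  have "regular_on (param_space E)
      (\<lambda>\<theta>. lyapunov_step m (fst \<theta>) (w \<theta>) (lyapunov_cumulant m (fst \<theta>) (w \<theta>)) js)"
  proof (cases "length js = m")
    case True
    have "regular_on (param_space E) (\<lambda>\<theta>. ((\<Sum>is | length is = m \<and> total_depth is < total_depth js.
        kron (fst \<theta>) js is * lyapunov_cumulant m (fst \<theta>) (w \<theta>) is) + diag_tensor m (w \<theta>) js)
        * inverse (1 - kron (fst \<theta>) js js))"
      by (intro regular_on_mult regular_on_add regular_on_sum regular_on_inverse regular_on_diff
          regular_on_const regular_on_kron diag less nz True) auto
    then show ?thesis
      unfolding lyapunov_step_def divide_inverse by (simp only: True if_True simp_thms)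
  next
    case False
    then show ?thesis by (simp add: lyapunov_step_def regular_on_const)
  qed
  moreover have "lyapunov_step m (fst \<theta>) (w \<theta>) (lyapunov_cumulant m (fst \<theta>) (w \<theta>)) js
      = lyapunov_cumulant m (fst \<theta>) (w \<theta>) js" if "\<theta> \<in> param_space E" for \<theta>
    by (rule sym, rule spec[OF iffD1[OF lyapunov_solution_iff_step[OF stable[OF that] m]
            lyapunov_cumulant_solution[OF stable[OF that] m]]])
  ultimately show ?case by (rule regular_on_cong)
qed

definition identifying_det :: "'n \<Rightarrow> 'n param \<Rightarrow> real" where
  "identifying_det j = (\<lambda>(A, \<omega>2, \<omega>3, \<omega>4).
     det (ancestor_matrix A \<omega>2 \<omega>3 (lyapunov_cumulant 2 A \<omega>2) (lyapunov_cumulant 3 A \<omega>3) j))"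

lemma regular_on_identifying_det: "regular_on (param_space E) (identifying_det j)"
proof -
  have "regular_on (param_space E) (\<lambda>\<theta>. det (ancestor_matrix (fst \<theta>) (fst (snd \<theta>)) (fst (snd (snd \<theta>)))
    (lyapunov_cumulant 2 (fst \<theta>) (fst (snd \<theta>))) (lyapunov_cumulant 3 (fst \<theta>) (fst (snd (snd \<theta>)))) j))"
  proof (rule regular_on_det)
    fix u l
    show "regular_on (param_space E) (\<lambda>\<theta>. ancestor_matrix (fst \<theta>) (fst (snd \<theta>)) (fst (snd (snd \<theta>)))
      (lyapunov_cumulant 2 (fst \<theta>) (fst (snd \<theta>))) (lyapunov_cumulant 3 (fst \<theta>) (fst (snd (snd \<theta>)))) j $ u $ l)"
      by (cases "u \<in> ancestors E j \<and> l \<in> ancestors E j"; cases "u = l")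
        (auto simp: ancestor_matrix_def obstruction_def
          intro!: regular_on_intros regular_on_coordinates regular_on_lyapunov_cumulant)
  qed
  then show ?thesis by (simp add: identifying_det_def case_prod_unfold)
qed

section \<open>A line of parameters leaving the exceptional set\<close>

definition perturbed_param :: "real \<Rightarrow> 'n param" where
  "perturbed_param t =
     (\<chi> j i. if i = j then 1 / 2 else if (i, j) \<in> E then t else 0, 1, 1, 1)"

lemma perturbed_param_in:
  assumes "\<forall>i. (i, i) \<in> E"
  shows "perturbed_param t \<in> param_space E"
proof -
  have "fst (perturbed_param t) \<in> edge_matrices E"
    using assms by (auto simp: perturbed_param_def edge_matrices_def)
  moreover from this have "schur_stable (fst (perturbed_param t))"
    by (rule schur_stableI) (simp add: perturbed_param_def)
  ultimately show ?thesis
    by (auto simp: perturbed_param_def param_space_def stable_edge_matrices_def)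
qed

lemma identifying_det_perturbed_0:
  assumes "\<forall>i. (i, i) \<in> E"
  shows "identifying_det j (perturbed_param 0) \<noteq> 0"
proof -
  define A where "A = fst (perturbed_param 0)"
  define S where "S = lyapunov_cumulant 2 A 1"
  define T where "T = lyapunov_cumulant 3 A 1"
  have A: "A $ u $ k = (if k = u then 1 / 2 else 0)" for u k
    by (simp add: A_def perturbed_param_def)
  have row: "(\<Sum>k\<in>UNIV. A $ u $ k * g k) = g u / 2" for u g
    by (simp add: A if_distrib if_distribR cong: if_cong)
  have stable: "A \<in> stable_edge_matrices E"
    using perturbed_param_in[OF assms, of 0] by (auto simp: A_def param_space_def)
  \<comment> \<open>For \<open>A = I/2\<close> the diagonal values are 1/(1 - 1/4) = 4/3 and, in
    order three, 1/(1 - 1/8) = 8/7.\<close>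
  have S: "S [u, l] = (if u = l then 4 / 3 else 0)" for u l
    using lyapunov_solution_2[OF lyapunov_cumulant_solution[OF stable], of 1 u l, unfolded row]
    by (simp add: S_def split: if_splits)
  have T: "T [u, v, l] = (if u = v \<and> v = l then 8 / 7 else 0)" for u v l
    using lyapunov_solution_3[OF lyapunov_cumulant_solution[OF stable], of 1 u v l, unfolded row]
    by (cases "u = v \<and> v = l") (auto simp: T_def)
  let ?M = "ancestor_matrix A 1 1 S T j"
  \<comment> \<open>2/3 is 4/3 times the single factor 1/2 from \<open>A\<close>, and 2/7 is 8/7
    times two such factors.\<close>
  have M: "?M $ u $ l = (if u = l then if u \<in> ancestors E j then 2 / 3 - 2 / 7 else 1 else 0)" for u l
    unfolding ancestor_matrix_def obstruction_def row by (simp add: S T)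
  have "det ?M = (\<Prod>i\<in>UNIV. ?M $ i $ i)"
    by (rule det_diagonal) (simp add: M)
  also have "\<dots> \<noteq> 0" by (simp add: M)
  finally show ?thesis
    by (simp add: identifying_det_def S_def T_def A_def) (simp add: perturbed_param_def)
qed

text \<open>The determinants are computed at \<open>t = 0\<close>, where non-loop edges have weight
  zero; continuity allows a small nonzero \<open>t\<close>, for which all edge weights are
  nonzero.\<close>

lemma perturbed_param_polynomial_nonzero:
  assumes "real_polynomial_function f" "f (perturbed_param 0) \<noteq> 0"
  obtains t where "t \<noteq> 0" "f (perturbed_param t) \<noteq> 0"
proof -
  define D :: "'n param" where "D = (\<chi> j i. if i \<noteq> j \<and> (i, j) \<in> E then 1 else 0, 0, 0, 0)"
  have "perturbed_param = (\<lambda>t. perturbed_param 0 + t *\<^sub>R D)"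
    by (rule ext) (simp add: perturbed_param_def D_def vec_eq_iff)
  moreover have "isCont (\<lambda>t. perturbed_param 0 + t *\<^sub>R D) 0"
    by (intro continuous_intros)
  ultimately have "isCont perturbed_param 0"
    by (rule ssubst[where P="\<lambda>g. isCont g 0"])
  then have "isCont (\<lambda>t. f (perturbed_param t)) 0"
    using continuous_real_polymonial_function[OF assms(1)] by (rule isCont_o2)
  then have "\<forall>\<^sub>F t in at 0. f (perturbed_param t) \<noteq> 0"
    using assms(2) by (intro tendsto_imp_eventually_ne) (auto simp: isCont_def)
  then have "\<forall>\<^sub>F t in at 0. t \<noteq> 0 \<and> f (perturbed_param t) \<noteq> 0"
    by (intro eventually_conj) (auto simp: eventually_at_filter)
  then show ?thesis
    using that eventually_happens[of _ "at (0::real)"] trivial_limit_at[of "0::real"] by blast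
qed

section \<open>Recovering all parameters off the exceptional set\<close>

lemma cumulants_injective_at:
  assumes no_isolated: "\<And>i. \<not> isolated_node E i"
    and \<theta>: "\<theta> \<in> param_space E" "\<theta>' \<in> param_space E" and eq: "cumulants \<theta>' = cumulants \<theta>"
    and det: "\<And>j. identifying_det j \<theta> \<noteq> 0"
    and edges: "\<And>i j. (i, j) \<in> E \<Longrightarrow> fst \<theta> $ j $ i \<noteq> 0"
  shows "\<theta>' = \<theta>"
proof -
  obtain A \<omega>2 \<omega>3 \<omega>4 where \<theta>_eq: "\<theta> = (A, \<omega>2, \<omega>3, \<omega>4)" by (metis prod.exhaust)
  obtain A' \<omega>2' \<omega>3' \<omega>4' where \<theta>'_eq: "\<theta>' = (A', \<omega>2', \<omega>3', \<omega>4')" by (metis prod.exhaust)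
  have stable: "A \<in> stable_edge_matrices E" "A' \<in> stable_edge_matrices E"
    and loops: "\<And>i. A $ i $ i \<noteq> 0" "\<And>i. A' $ i $ i \<noteq> 0"
    and noise: "\<And>i. \<omega>2 $ i > 0" "\<And>i. \<omega>3 $ i \<noteq> 0" "\<And>i. \<omega>4 $ i > 0"
    using \<theta> by (auto simp: \<theta>_eq \<theta>'_eq param_space_def)
  then have edge: "A \<in> edge_matrices E" "A' \<in> edge_matrices E"
    by (auto simp: stable_edge_matrices_def)
  define S where "S = lyapunov_cumulant 2 A \<omega>2"
  define T where "T = lyapunov_cumulant 3 A \<omega>3"
  define R where "R = lyapunov_cumulant 4 A \<omega>4"
  have sol: "lyapunov_solution 2 A \<omega>2 S" "lyapunov_solution 3 A \<omega>3 T" "lyapunov_solution 4 A \<omega>4 R"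
    unfolding S_def T_def R_def by (rule lyapunov_cumulant_solution[OF stable(1)]; simp)+
  have eq': "lyapunov_cumulant 2 A' \<omega>2' = S" "lyapunov_cumulant 3 A' \<omega>3' = T"
    "lyapunov_cumulant 4 A' \<omega>4' = R"
    using eq by (auto simp: cumulants_def \<theta>_eq \<theta>'_eq S_def T_def R_def)
  have sol': "lyapunov_solution 2 A' \<omega>2' S" "lyapunov_solution 3 A' \<omega>3' T" "lyapunov_solution 4 A' \<omega>4' R"
    unfolding eq'[symmetric] by (rule lyapunov_cumulant_solution[OF stable(2)]; simp)+
  \<comment> \<open>Rows are recovered from the sources downwards: a source has only its loop
    weight, and any other node has ancestors whose rows are already known.\<close>
  have "A' $ j = A $ j" for j
  proof (induction "depth E j" arbitrary: j rule: less_induct)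
    case less
    show ?case
    proof (cases "ancestors E j = {}")
      case True
      let ?case = "\<lambda>x y z m. if m = 2 then x else if m = (3::nat) then y else z"
      have "A $ j $ j = A' $ j $ j"
        by (rule source_loop_weight_unique[OF stable, of "?case \<omega>2 \<omega>3 \<omega>4" "?case S T R" "?case \<omega>2' \<omega>3' \<omega>4'"])
          (use sol sol' noise[of j] loops edges True no_isolated in \<open>auto simp: \<theta>_eq\<close>)
      then show ?thesis
        using source_row[OF edge(1) True] source_row[OF edge(2) True] by (metis vec_eq_iff)
    next
      case False
      then obtain p where p: "(p, j) \<in> E" "p \<noteq> j"
        unfolding ancestors_def by (auto dest: tranclD2)
      show ?thesis
      proof (rule row_unique[OF edge loops(1) sol(1) sol'(1) sol(2) sol'(2)])
        show "\<omega>2 $ i \<noteq> 0" for i using noise(1)[of i] by simp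
        show "det (ancestor_matrix A \<omega>2 \<omega>3 S T j) \<noteq> 0"
          using det[of j] by (simp add: identifying_det_def \<theta>_eq S_def T_def)
        show "p \<in> ancestors E j" "A $ j $ p \<noteq> 0"
          using p parent_ancestor edges by (auto simp: \<theta>_eq)
        show "A' $ u = A $ u" if "u \<in> ancestors E j" for u
          by (rule less[OF depth_less[OF that]])
      qed
    qed
  qed
  then have "A' = A" by (simp add: vec_eq_iff)
  moreover have "\<omega>2' = \<omega>2" "\<omega>3' = \<omega>3" "\<omega>4' = \<omega>4"
    using sol sol' lyapunov_solution_unique_diag[of 1 A] lyapunov_solution_unique_diag[of 2 A]
      lyapunov_solution_unique_diag[of 3 A] unfolding \<open>A' = A\<close>
    by (simp_all add: numeral_eq_Suc)
  ultimately show ?thesis by (simp add: \<theta>_eq \<theta>'_eq)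
qed

end

theorem corollary4p5:
  fixes E :: "('n::finite \<times> 'n) set"
  assumes "CARD('n) \<ge> 2"
    and "\<forall>i. (i, i) \<in> E"
    and "acyclic (E - Id)"
    and "\<forall>i. \<not> isolated_node E i"
  shows "generically_identifiable (param_space E) cumulants"
proof -
  interpret loop_dag E by unfold_locales fact
  obtain p q where p: "\<And>j. real_polynomial_function (p j)"
    and pq: "\<And>j \<theta>. \<theta> \<in> param_space E \<Longrightarrow> q j \<theta> \<noteq> 0 \<and> identifying_det j \<theta> = p j \<theta> / q j \<theta>"
    using regular_on_identifying_det unfolding regular_on_def by metis
  \<comment> \<open>\<open>f\<close> keeps every determinant nonzero and \<open>g\<close> every edge
    weight; the zero set of their product is the exceptional set.\<close>
  define f where "f \<theta> = (\<Prod>j\<in>UNIV. p j \<theta>)" for \<theta>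
  define g :: "'n param \<Rightarrow> real" where "g \<theta> = (\<Prod>(i, j)\<in>E. fst \<theta> $ j $ i)" for \<theta>
  define Z where "Z = {\<theta> \<in> param_space E. f \<theta> * g \<theta> = 0}"
  have f: "real_polynomial_function f"
    unfolding f_def using p by (intro real_polynomial_function_prod) auto
  moreover have g: "real_polynomial_function g"
    unfolding g_def case_prod_unfold
    by (intro real_polynomial_function_prod real_polynomial_function_coordinates) auto
  ultimately have "algebraic_subset (param_space E) Z"
    unfolding algebraic_subset_def Z_def
    by (intro exI[of _ "{\<lambda>\<theta>. f \<theta> * g \<theta>}"]) (auto intro: real_polynomial_function.intros(4))
  moreover have "Z \<noteq> param_space E"
  proof -
    have "f (perturbed_param 0) \<noteq> 0"
      using identifying_det_perturbed_0[OF assms(2)] pq[OF perturbed_param_in[OF assms(2)]]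
      by (force simp: f_def)
    then obtain t where t: "t \<noteq> 0" "f (perturbed_param t) \<noteq> 0"
      using perturbed_param_polynomial_nonzero[OF f] by blast
    then have "g (perturbed_param t) \<noteq> 0"
      by (auto simp: g_def perturbed_param_def split: if_splits)
    then show ?thesis
      using t(2) perturbed_param_in[OF assms(2), of t] by (auto simp: Z_def)
  qed
  moreover have "{\<theta>' \<in> param_space E. cumulants \<theta>' = cumulants \<theta>} = {\<theta>}"
    if "\<theta> \<in> param_space E - Z" for \<theta>
  proof -
    have nz: "f \<theta> \<noteq> 0" "g \<theta> \<noteq> 0" and \<theta>: "\<theta> \<in> param_space E"
      using that by (auto simp: Z_def)
    have "identifying_det j \<theta> \<noteq> 0" for j
      using nz(1) pq[OF \<theta>, of j] by (auto simp: f_def)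
    moreover have "fst \<theta> $ j $ i \<noteq> 0" if "(i, j) \<in> E" for i j
      using nz(2) that by (auto simp: g_def)
    ultimately show ?thesis
      using cumulants_injective_at[of \<theta>] assms(4) \<theta> by blast
  qed
  ultimately show ?thesis
    unfolding generically_identifiable_def by blast
qed

end
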